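(* Let $m$ and $n$ be positive integers such that $n\ge m$, unless stated otherwise. Then: (1) $$\sum_{k=1}^{\infty}\frac{\zeta(2k)}{k\left(F_{n-m}^2F_{n+m}^2\right)^k}=\ln\left(\frac{\pi}{F_n^2+(-1)^{n+m-1}F_m^2}\right)+\ln\csc\left(\frac{\pi}{F_n^2+(-1)^{n+m-1}F_m^2}\right),\quad n>m;$$ (2) $$\sum_{k=1}^{\infty}\frac{\zeta(2k)}{k\left(L_m^2F_n^2\right)^k}=\ln\left(\frac{\pi}{F_{n+m}+(-1)^mF_{n-m}}\right)+\ln\csc\left(\frac{\pi}{F_{n+m}+(-1)^mF_{n-m}}\right);$$ (3) $$\sum_{k=1}^{\infty}\frac{\zeta(2k)}{4^k\,k\,F_{n+m}^{2k}}=\ln\left(\frac{\pi}{L_nF_m+F_nL_m}\right)+\ln\csc\left(\frac{\pi}{L_nF_m+F_nL_m}\right);$$ (4) $$\sum_{k=1}^{\infty}\frac{\zeta(2k)}{k\left(L_m^2L_n^2\right)^k}=\ln\left(\frac{\pi}{L_{n+m}+(-1)^mL_{n-m}}\right)+\ln\csc\left(\frac{\pi}{L_{n+m}+(-1)^mL_{n-m}}\right);$$ (5) $$\sum_{k=1}^{\infty}\frac{\zeta(2k)}{25^k\,k\left(F_m^2F_n^2\right)^k}=\ln\left(\frac{\pi}{L_{n+m}+(-1)^{m-1}L_{n-m}}\right)+\ln\csc\left(\frac{\pi}{L_{n+m}+(-1)^{m-1}L_{n-m}}\right).$$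
   Context: $\zeta$ denotes the Riemann zeta function. $F_n$ and $L_n$ denote the Fibonacci and Lucas numbers: both satisfy $x_n=x_{n-1}+x_{n-2}$ for $n\ge 2$, with $F_0=0$, $F_1=1$ and $L_0=2$, $L_1=1$.
   Formalization: In (2) for (m,n)=(1,1),(1,2) and in (4) for (1,1) the series diverges and csc(π) is undefined; there the identity is replaced by: the partial sums tend to +∞, and so does ln x + ln csc x as x increases to π. *)

theory Defs
  imports "HOL-Analysis.Analysis" "HOL-Number_Theory.Fib"
begin

fun lucas :: "nat \<Rightarrow> nat" where
  "lucas 0 = 2"
| "lucas (Suc 0) = 1"
| "lucas (Suc (Suc n)) = lucas (Suc n) + lucas n"

(* The Riemann zeta function on the real half-line s > 1, where it is given by its
   Dirichlet series.  For s <= 1 the series diverges and the value is meaningless. *)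
definition zeta :: "real \<Rightarrow> real" where
  "zeta s = (\<Sum>n. 1 / real (Suc n) powr s)"

lemma zeta_sums: "(\<lambda>n. 1 / real (Suc n) powr s) sums zeta s" if "s > 1"
proof -
  have "summable (\<lambda>n. real n powr (- s))"
    using that by (subst summable_real_powr_iff) auto
  then have "summable (\<lambda>n. real (Suc n) powr (- s))"
    by (subst summable_Suc_iff)
  then have "summable (\<lambda>n. 1 / real (Suc n) powr s)"
    by (simp add: powr_minus divide_inverse)
  then show ?thesis
    unfolding zeta_def by (rule summable_sums)
qed

(* csc has poles at the multiples of pi; there division by zero gives csc x = 0. *)
definition csc :: "real \<Rightarrow> real" where
  "csc x = 1 / sin x"

end

theory Submission
  imports Defs
begin

text \<open>
  All five series are one series.  For a real number \<open>D > 1\<close>,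
  \[ \sum_{k \ge 1} \frac{\zeta(2k)}{k D^{2k}} = \ln\frac{\pi}{D} + \ln\csc\frac{\pi}{D}, \]
  and each part evaluates this at a positive integer \<open>D\<close> that a Fibonacci--Lucas identity
  writes in two ways: as the number whose powers occur in the series (a product of two Fibonacci or
  Lucas numbers, five times such a product in part five, and \<open>2 F\<^bsub>n+m\<^esub>\<close> in part three),
  and as the sum or difference occurring on the right-hand side.

  The analytic identity is Euler's product for the sine in logarithmic form.  With \<open>x = 1/D\<close>,
  \[ -\ln\frac{\sin \pi x}{\pi x} = \sum_{j \ge 1} -\ln\Bigl(1 - \frac{x^2}{j^2}\Bigr)
     = \sum_{j \ge 1} \sum_{k \ge 1} \frac{x^{2k}}{k\, j^{2k}} , \]
  and since all terms are nonnegative the order of summation can be exchanged, after which the sum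
  over \<open>j\<close> is \<open>\<zeta>(2k)\<close> (\<open>zeta_even_power_series\<close>, \<open>zeta_even_series_reciprocal\<close>).

  The arithmetic identities come from Binet's formulas: with \<open>n = m + d\<close> they become polynomial
  identities in the \<open>m\<close>-th and \<open>d\<close>-th powers of the two roots \<open>\<phi>, \<psi>\<close> of \<open>t\<^sup>2 = t + 1\<close>, where the
  signs enter through \<open>\<phi> \<psi> = -1\<close>.

  If \<open>D = 1\<close>, the terms of the series are at least \<open>1/k\<close> because \<open>\<zeta>(2k) \<ge> 1\<close>, so the partial sums
  dominate the harmonic numbers; on the other side, \<open>csc\<close> tends to infinity at \<open>\<pi>\<close> from the left.
\<close>

section \<open>Even zeta values and the logarithm of the sine\<close>

lemma zeta_even_sums:
  "(\<lambda>j. 1 / real (Suc j) ^ (2 * Suc k)) sums zeta (real (2 * Suc k))"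
proof -
  have "(\<lambda>j. 1 / real (Suc j) powr real (2 * Suc k)) sums zeta (real (2 * Suc k))"
    by (rule zeta_sums) simp
  then show ?thesis
    by (subst (asm) powr_realpow) simp_all
qed

lemma zeta_even_ge_1: "zeta (real (2 * Suc k)) \<ge> 1"
proof -
  have "(\<Sum>j\<in>{0}. 1 / real (Suc j) ^ (2 * Suc k)) \<le> (\<Sum>j. 1 / real (Suc j) ^ (2 * Suc k))"
    by (rule sum_le_suminf[OF sums_summable[OF zeta_even_sums]]) auto
  then show ?thesis
    unfolding sums_unique[OF zeta_even_sums, symmetric] by simp
qed

lemma minus_ln_one_minus_sums:
  fixes t :: real
  assumes "\<bar>t\<bar> < 1"
  shows "(\<lambda>k. t ^ Suc k / real (Suc k)) sums (- ln (1 - t))"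
proof -
  have "(\<lambda>k. - (t ^ k) / real k) sums ln (1 - t)"
    using ln_series'[of "- t"] assms by simp
  then have "(\<lambda>k. t ^ k / real k) sums (- ln (1 - t))"
    using sums_minus by fastforce
  then show ?thesis
    by (subst sums_Suc_iff) simp
qed

text \<open>
  The logarithm of Euler's product.  For \<open>0 < x < 1\<close> every factor and the limit are positive, so the
  logarithm turns the convergent product into a convergent series.
\<close>

lemma ln_sine_product_sums:
  fixes x :: real
  assumes "0 < x" "x < 1"
  shows "(\<lambda>j. - ln (1 - x\<^sup>2 / (real (Suc j))\<^sup>2)) sums (- ln (sin (pi * x) / (pi * x)))"
proof -
  have factor_pos: "1 - x\<^sup>2 / (real k)\<^sup>2 > 0" if "k \<ge> 1" for k
  proof -
    have "x < real k" using assms that by linarith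
    then have "x\<^sup>2 < (real k)\<^sup>2" using assms by (intro power_strict_mono) auto
    then show ?thesis using that by (simp add: field_simps)
  qed
  have limit_pos: "sin (pi * x) / (pi * x) > 0"
    using assms by (intro divide_pos_pos sin_gt_zero) auto
  have "(\<lambda>N. \<Prod>k=1..N. 1 - x\<^sup>2 / (real k)\<^sup>2) \<longlonglongrightarrow> sin (pi * x) / (pi * x)"
    using sin_product_formula_real'[of x] assms by simp
  then have "(\<lambda>N. ln (\<Prod>k=1..N. 1 - x\<^sup>2 / (real k)\<^sup>2)) \<longlonglongrightarrow> ln (sin (pi * x) / (pi * x))"
    using limit_pos by (intro tendsto_ln) auto
  moreover have "ln (\<Prod>k=1..N. 1 - x\<^sup>2 / (real k)\<^sup>2)
      = (\<Sum>j<N. ln (1 - x\<^sup>2 / (real (Suc j))\<^sup>2))" for N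
  proof -
    have "ln (\<Prod>k=1..N. 1 - x\<^sup>2 / (real k)\<^sup>2) = (\<Sum>k=1..N. ln (1 - x\<^sup>2 / (real k)\<^sup>2))"
      by (rule ln_prod) (simp, metis atLeastAtMost_iff factor_pos less_irrefl)
    also have "\<dots> = (\<Sum>j<N. ln (1 - x\<^sup>2 / (real (Suc j))\<^sup>2))"
      by (simp only: One_nat_def sum.atLeast1_atMost_eq)
    finally show ?thesis .
  qed
  ultimately have "(\<lambda>j. ln (1 - x\<^sup>2 / (real (Suc j))\<^sup>2)) sums ln (sin (pi * x) / (pi * x))"
    by (simp add: sums_def)
  then show ?thesis by (rule sums_minus)
qed

text \<open>
  The row sums (over \<open>k\<close>) of the double series with terms \<open>x\<^sup>2\<^sup>k / (k j\<^sup>2\<^sup>k)\<close> are logarithms of the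
  factors of Euler's product, its column sums (over \<open>j\<close>) are multiples of zeta values.
\<close>

lemma zeta_even_power_series:
  fixes x :: real
  assumes "0 < x" "x < 1"
  shows "(\<lambda>k. zeta (real (2 * Suc k)) * (x\<^sup>2) ^ Suc k / real (Suc k))
           sums (- ln (sin (pi * x) / (pi * x)))"
    (is "_ sums ?S")
proof -
  define f where "f j k = (x\<^sup>2 / (real (Suc j))\<^sup>2) ^ Suc k / real (Suc k)" for j k
  define g where "g j = - ln (1 - x\<^sup>2 / (real (Suc j))\<^sup>2)" for j
  have f_nonneg: "f j k \<ge> 0" for j k
    by (simp add: f_def)
  have rows: "(f j has_sum g j) UNIV" for j
  proof (rule sums_nonneg_imp_has_sum[OF _ f_nonneg])
    have "x < real (Suc j)" using assms by simp
    then have "x\<^sup>2 < (real (Suc j))\<^sup>2" using assms by (intro power_strict_mono) auto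
    then have "\<bar>x\<^sup>2 / (real (Suc j))\<^sup>2\<bar> < 1" by simp
    then show "f j sums g j"
      unfolding f_def g_def by (rule minus_ln_one_minus_sums)
  qed
  have g_nonneg: "g j \<ge> 0" for j
    using has_sum_nonneg[OF rows] f_nonneg by blast
  have g_sum: "(g has_sum ?S) UNIV"
    using ln_sine_product_sums[OF assms, folded g_def] g_nonneg
    by (rule sums_nonneg_imp_has_sum)
  have "(\<lambda>(j, k). f j k) summable_on UNIV \<times> UNIV"
    using rows f_nonneg g_sum by (intro summable_on_SigmaI[where g = g]) (auto simp: summable_on_def)
  then have "((\<lambda>(j, k). f j k) has_sum ?S) (UNIV \<times> UNIV)"
    using rows g_sum by (intro has_sum_SigmaI[where g = g]) auto
  then have double: "((\<lambda>(k, j). f j k) has_sum ?S) (UNIV \<times> UNIV)"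
    by (subst (asm) has_sum_swap) simp
  have columns: "((\<lambda>j. f j k) has_sum (zeta (real (2 * Suc k)) * (x\<^sup>2) ^ Suc k / real (Suc k))) UNIV" for k
  proof (rule sums_nonneg_imp_has_sum[OF _ f_nonneg])
    have "(\<lambda>j. 1 / real (Suc j) ^ (2 * Suc k) * ((x\<^sup>2) ^ Suc k / real (Suc k)))
            sums (zeta (real (2 * Suc k)) * ((x\<^sup>2) ^ Suc k / real (Suc k)))"
      by (intro sums_mult2 zeta_even_sums)
    moreover have "1 / real (Suc j) ^ (2 * Suc k) * ((x\<^sup>2) ^ Suc k / real (Suc k)) = f j k" for j
      unfolding f_def power_divide power_mult by simp
    ultimately show "(\<lambda>j. f j k) sums (zeta (real (2 * Suc k)) * (x\<^sup>2) ^ Suc k / real (Suc k))"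
      by simp
  qed
  have "((\<lambda>k. zeta (real (2 * Suc k)) * (x\<^sup>2) ^ Suc k / real (Suc k)) has_sum ?S) UNIV"
    using has_sum_SigmaD[OF double] columns by simp
  then show ?thesis by (rule has_sum_imp_sums)
qed

text \<open>
  The form shared by all five series, with the quotient on the right split into two logarithms; the
  condition \<open>D > 1\<close> makes \<open>sin (\<pi>/D)\<close> positive.
\<close>

lemma zeta_even_series_reciprocal:
  fixes D :: real
  assumes "D > 1"
  shows "(\<lambda>k. zeta (real (2 * Suc k)) / (real (Suc k) * (D\<^sup>2) ^ Suc k))
           sums (ln (pi / D) + ln (csc (pi / D)))"
proof -
  have "pi / D < pi" using assms by (simp add: field_simps)
  then have sin_pos: "sin (pi / D) > 0" using assms by (intro sin_gt_zero) auto
  have "- ln (sin (pi * (1 / D)) / (pi * (1 / D))) = ln (pi / D) + ln (csc (pi / D))"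
    using sin_pos assms by (simp add: csc_def ln_div ln_mult)
  moreover have "zeta (real (2 * Suc k)) * ((1 / D)\<^sup>2) ^ Suc k / real (Suc k)
      = zeta (real (2 * Suc k)) / (real (Suc k) * (D\<^sup>2) ^ Suc k)" for k
    unfolding power_divide by simp
  ultimately show ?thesis
    using zeta_even_power_series[of "1 / D"] assms by simp
qed

section \<open>Divergence at the pole\<close>

lemma zeta_even_harmonic_at_top:
  "filterlim (\<lambda>N. \<Sum>k<N. zeta (real (2 * Suc k)) / real (Suc k)) at_top sequentially"
proof (rule filterlim_at_top_mono[OF harm_at_top])
  show "\<forall>\<^sub>F N in sequentially. harm N \<le> (\<Sum>k<N. zeta (real (2 * Suc k)) / real (Suc k))"
  proof (intro always_eventually allI)
    fix N
    have "harm N = (\<Sum>k<N. 1 / real (Suc k))"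
      unfolding harm_def inverse_eq_divide by (simp only: One_nat_def sum.atLeast1_atMost_eq)
    also have "\<dots> \<le> (\<Sum>k<N. zeta (real (2 * Suc k)) / real (Suc k))"
      by (intro sum_mono divide_right_mono zeta_even_ge_1) auto
    finally show "harm N \<le> (\<Sum>k<N. zeta (real (2 * Suc k)) / real (Suc k))" .
  qed
qed

lemma ln_plus_ln_csc_at_left_pi: "filterlim (\<lambda>x. ln x + ln (csc x)) at_top (at_left pi)"
proof (rule filterlim_tendsto_add_at_top)
  show "(ln \<longlongrightarrow> ln pi) (at_left pi)"
    by (intro tendsto_ln tendsto_ident_at) simp
  have "(sin \<longlongrightarrow> sin pi) (at_left pi)"
    by (intro tendsto_intros)
  moreover have "\<forall>\<^sub>F x in at_left pi. 0 < sin x"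
    using eventually_at_left_real[of 0 pi] by (rule eventually_mono) (auto intro: sin_gt_zero)
  ultimately have "filterlim (\<lambda>x. inverse (sin x)) at_top (at_left pi)"
    by (intro filterlim_inverse_at_top) auto
  then show "filterlim (\<lambda>x. ln (csc x)) at_top (at_left pi)"
    unfolding csc_def inverse_eq_divide by (rule filterlim_compose[OF ln_at_top])
qed

section \<open>Fibonacci and Lucas products\<close>

definition golden :: real where "golden = (1 + sqrt 5) / 2"
definition golden_conj :: real where "golden_conj = (1 - sqrt 5) / 2"

lemma golden_mult_conj: "golden * golden_conj = - 1"
  by (simp add: golden_def golden_conj_def field_simps)

lemma golden_power_mult_conj: "golden ^ n * golden_conj ^ n = (- 1) ^ n"
  by (metis golden_mult_conj power_mult_distrib)

lemma fib_binet: "real (fib n) = (golden ^ n - golden_conj ^ n) / sqrt 5"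
  using fib_closed_form[of n] by (simp add: golden_def golden_conj_def)

lemma lucas_binet: "real (lucas n) = golden ^ n + golden_conj ^ n"
proof (induction n rule: lucas.induct)
  case (3 n)
  have "golden ^ Suc (Suc n) = golden ^ Suc n + golden ^ n"
    and "golden_conj ^ Suc (Suc n) = golden_conj ^ Suc n + golden_conj ^ n"
    by (simp_all add: golden_def golden_conj_def field_simps)
  with 3 show ?case by simp
qed (simp_all add: golden_def golden_conj_def field_simps)

lemma fib_mult_fib_catalan:
  assumes "m \<le> n" "n > 0"
  shows "real (fib (n - m)) * real (fib (n + m))
           = (real (fib n))\<^sup>2 + (- 1) ^ (n + m - 1) * (real (fib m))\<^sup>2"
proof -
  obtain d where n: "n = m + d" using assms(1) le_Suc_ex by blast
  define a b c e where "a = golden ^ m" "b = golden_conj ^ m" "c = golden ^ d" "e = golden_conj ^ d"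
  note abce = this
  \<comment> \<open>Since \<open>n + m\<close> and \<open>d\<close> have the same parity, \<open>(-1)\<^bsup>n+m-1\<^esup> = -(\<phi>\<psi>)\<^sup>d\<close>.\<close>
  have "n + m - 1 + 1 = d + 2 * m" using assms n by simp
  then have "(- 1 :: real) ^ (n + m - 1) * (- 1) = (- 1) ^ d"
    by (metis power_add power_minus1_even mult_1_right power_one_right)
  then have sgn: "(- 1 :: real) ^ (n + m - 1) = - (c * e)"
    by (simp add: abce golden_power_mult_conj)
  have F: "real (fib (n - m)) = (c - e) / sqrt 5" "real (fib (n + m)) = (a\<^sup>2 * c - b\<^sup>2 * e) / sqrt 5"
    "real (fib n) = (a * c - b * e) / sqrt 5" "real (fib m) = (a - b) / sqrt 5"
    by (simp_all add: fib_binet n abce power_add power2_eq_square)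
  show ?thesis
    unfolding F sgn power_divide by (simp add: field_simps power2_eq_square)
qed

text \<open>
  For Fibonacci and Lucas numbers alike, a product of two Binet formulas at \<open>m\<close> and \<open>m + d\<close> expands
  into pure powers with exponent \<open>2 m + d\<close> and mixed terms, which are \<open>(\<phi>\<psi>)\<^sup>m = (-1)\<^sup>m\<close> times powers
  with exponent \<open>d\<close>.  The two kinds of numbers differ only in the signs of the powers of \<open>\<psi>\<close> and in
  the factor \<open>1/\<surd>5\<close>.
\<close>

lemma lucas_mult_fib:
  assumes "m \<le> n"
  shows "real (lucas m) * real (fib n) = real (fib (n + m)) + (- 1) ^ m * real (fib (n - m))"
proof -
  obtain d where n: "n = m + d" using assms le_Suc_ex by blast
  show ?thesis
    unfolding n golden_power_mult_conj[symmetric]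
    by (simp add: fib_binet lucas_binet power_add field_simps)
qed

text \<open>The mixed terms of the two products cancel.\<close>

lemma double_fib_add:
  "2 * real (fib (n + m)) = real (lucas n) * real (fib m) + real (fib n) * real (lucas m)"
  by (simp add: fib_binet lucas_binet power_add field_simps)

lemma lucas_mult_lucas:
  assumes "m \<le> n"
  shows "real (lucas m) * real (lucas n) = real (lucas (n + m)) + (- 1) ^ m * real (lucas (n - m))"
proof -
  obtain d where n: "n = m + d" using assms le_Suc_ex by blast
  show ?thesis
    unfolding n golden_power_mult_conj[symmetric]
    by (simp add: lucas_binet power_add field_simps)
qed

lemma five_fib_mult_fib:
  assumes "m \<le> n" "m > 0"
  shows "5 * real (fib m) * real (fib n)
           = real (lucas (n + m)) + (- 1) ^ (m - 1) * real (lucas (n - m))"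
proof -
  obtain d where n: "n = m + d" using assms le_Suc_ex by blast
  have sgn: "(- 1 :: real) ^ (m - 1) = - (golden ^ m * golden_conj ^ m)"
    unfolding golden_power_mult_conj using assms(2) by (cases m) auto
  show ?thesis
    unfolding n sgn by (simp add: fib_binet lucas_binet power_add field_simps)
qed

lemma lucas_pos: "lucas n > 0"
  by (induction n rule: lucas.induct) auto

lemma lucas_ge_3: "n \<ge> 2 \<Longrightarrow> lucas n \<ge> 3"
proof (induction n rule: lucas.induct)
  case (3 n)
  then show ?case using lucas_pos[of n] by (cases n) (auto simp: Suc_le_eq numeral_eq_Suc)
qed auto

lemma fib_ge_2: "n \<ge> 3 \<Longrightarrow> fib n \<ge> 2"
  using fib_mono[of 3 n] by (simp add: numeral_eq_Suc)

section \<open>The five series\<close>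

(* Every series runs over k = 1, 2, ..., encoded by Suc k.
   For L_m F_n = 1 in (2), i.e. m = 1 and n = 1, 2, and for L_m L_n = 1 in (4), i.e. m = n = 1,
   the right-hand side is ln pi + ln (csc pi), with a pole of csc, and the series diverges.  The
   identity then reads "infinity = infinity": the partial sums tend to infinity, and so does
   ln x + ln (csc x) as x increases to the argument pi / (...). *)
theorem theorem3p2p2:
  fixes m n :: nat
  assumes "m \<ge> 1" and "n \<ge> m"
  shows
    "(n > m \<longrightarrow>
       (\<lambda>k. zeta (real (2 * Suc k)) /
              (real (Suc k) * ((real (fib (n - m)))\<^sup>2 * (real (fib (n + m)))\<^sup>2) ^ Suc k))
       sums
         (ln (pi / ((real (fib n))\<^sup>2 + (-1) ^ (n + m - 1) * (real (fib m))\<^sup>2)) +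
          ln (csc (pi / ((real (fib n))\<^sup>2 + (-1) ^ (n + m - 1) * (real (fib m))\<^sup>2))))) \<and>
     (\<not> (m = 1 \<and> n \<le> 2) \<longrightarrow>
       (\<lambda>k. zeta (real (2 * Suc k)) /
              (real (Suc k) * ((real (lucas m))\<^sup>2 * (real (fib n))\<^sup>2) ^ Suc k))
       sums
         (ln (pi / (real (fib (n + m)) + (-1) ^ m * real (fib (n - m)))) +
          ln (csc (pi / (real (fib (n + m)) + (-1) ^ m * real (fib (n - m))))))) \<and>
     (m = 1 \<and> n \<le> 2 \<longrightarrow>
       filterlim
         (\<lambda>N. \<Sum>k<N. zeta (real (2 * Suc k)) /
              (real (Suc k) * ((real (lucas m))\<^sup>2 * (real (fib n))\<^sup>2) ^ Suc k))
         at_top sequentially \<and>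
       filterlim (\<lambda>x. ln x + ln (csc x)) at_top
         (at_left (pi / (real (fib (n + m)) + (-1) ^ m * real (fib (n - m)))))) \<and>
     ((\<lambda>k. zeta (real (2 * Suc k)) /
              (4 ^ Suc k * real (Suc k) * real (fib (n + m)) ^ (2 * Suc k)))
       sums
         (ln (pi / (real (lucas n) * real (fib m) + real (fib n) * real (lucas m))) +
          ln (csc (pi / (real (lucas n) * real (fib m) + real (fib n) * real (lucas m)))))) \<and>
     (\<not> (m = 1 \<and> n = 1) \<longrightarrow>
       (\<lambda>k. zeta (real (2 * Suc k)) /
              (real (Suc k) * ((real (lucas m))\<^sup>2 * (real (lucas n))\<^sup>2) ^ Suc k))
       sums
         (ln (pi / (real (lucas (n + m)) + (-1) ^ m * real (lucas (n - m)))) +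
          ln (csc (pi / (real (lucas (n + m)) + (-1) ^ m * real (lucas (n - m))))))) \<and>
     (m = 1 \<and> n = 1 \<longrightarrow>
       filterlim
         (\<lambda>N. \<Sum>k<N. zeta (real (2 * Suc k)) /
              (real (Suc k) * ((real (lucas m))\<^sup>2 * (real (lucas n))\<^sup>2) ^ Suc k))
         at_top sequentially \<and>
       filterlim (\<lambda>x. ln x + ln (csc x)) at_top
         (at_left (pi / (real (lucas (n + m)) + (-1) ^ m * real (lucas (n - m)))))) \<and>
     ((\<lambda>k. zeta (real (2 * Suc k)) /
              (25 ^ Suc k * real (Suc k) * ((real (fib m))\<^sup>2 * (real (fib n))\<^sup>2) ^ Suc k))
       sums
         (ln (pi / (real (lucas (n + m)) + (-1) ^ (m - 1) * real (lucas (n - m)))) +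
          ln (csc (pi / (real (lucas (n + m)) + (-1) ^ (m - 1) * real (lucas (n - m)))))))"
proof (intro conjI impI)
  have m_pos: "m > 0" and n_pos: "n > 0" using assms by auto
  have fib_ge_1: "fib k \<ge> 1" if "k > 0" for k
    using fib_neq_0_nat[OF that] by simp
  have lucas_ge_1: "lucas k \<ge> 1" for k
    using lucas_pos[of k] by simp
  have lucas_1: "lucas 1 = 1" by simp

  show "(\<lambda>k. zeta (real (2 * Suc k)) /
              (real (Suc k) * ((real (fib (n - m)))\<^sup>2 * (real (fib (n + m)))\<^sup>2) ^ Suc k))
       sums
         (ln (pi / ((real (fib n))\<^sup>2 + (-1) ^ (n + m - 1) * (real (fib m))\<^sup>2)) +
          ln (csc (pi / ((real (fib n))\<^sup>2 + (-1) ^ (n + m - 1) * (real (fib m))\<^sup>2))))"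
    if "n > m"
  proof -
    have "1 * 2 \<le> fib (n - m) * fib (n + m)"
      using assms that by (intro mult_le_mono fib_ge_1 fib_ge_2) auto
    then have "real (fib (n - m)) * real (fib (n + m)) > 1"
      by (simp flip: of_nat_mult)
    from zeta_even_series_reciprocal[OF this] show ?thesis
      unfolding fib_mult_fib_catalan[OF assms(2) n_pos, symmetric] power_mult_distrib[symmetric] .
  qed

  show "(\<lambda>k. zeta (real (2 * Suc k)) /
              (real (Suc k) * ((real (lucas m))\<^sup>2 * (real (fib n))\<^sup>2) ^ Suc k))
       sums
         (ln (pi / (real (fib (n + m)) + (-1) ^ m * real (fib (n - m)))) +
          ln (csc (pi / (real (fib (n + m)) + (-1) ^ m * real (fib (n - m))))))"
    if "\<not> (m = 1 \<and> n \<le> 2)"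
  proof -
    have "2 \<le> lucas m * fib n"
    proof (cases "m = 1")
      case True
      then have "1 * 2 \<le> lucas m * fib n"
        using that by (intro mult_le_mono lucas_ge_1 fib_ge_2) auto
      then show ?thesis by simp
    next
      case False
      then have "3 * 1 \<le> lucas m * fib n"
        using assms n_pos by (intro mult_le_mono lucas_ge_3 fib_ge_1) auto
      then show ?thesis by simp
    qed
    then have "real (lucas m) * real (fib n) > 1"
      by (simp flip: of_nat_mult)
    from zeta_even_series_reciprocal[OF this] show ?thesis
      unfolding lucas_mult_fib[OF assms(2), symmetric] power_mult_distrib[symmetric] .
  qed

  show "filterlim (\<lambda>N. \<Sum>k<N. zeta (real (2 * Suc k)) /
              (real (Suc k) * ((real (lucas m))\<^sup>2 * (real (fib n))\<^sup>2) ^ Suc k))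
         at_top sequentially"
    and "filterlim (\<lambda>x. ln x + ln (csc x)) at_top
         (at_left (pi / (real (fib (n + m)) + (-1) ^ m * real (fib (n - m)))))"
    if "m = 1 \<and> n \<le> 2"
  proof -
    have "n = 1 \<or> n = 2" using that assms by auto
    then have fib_n: "fib n = 1" by (auto simp: numeral_eq_Suc)
    have lucas_m: "lucas m = 1" using that lucas_1 by simp
    show "filterlim (\<lambda>N. \<Sum>k<N. zeta (real (2 * Suc k)) /
              (real (Suc k) * ((real (lucas m))\<^sup>2 * (real (fib n))\<^sup>2) ^ Suc k))
         at_top sequentially"
      unfolding fib_n lucas_m using zeta_even_harmonic_at_top by simp
    show "filterlim (\<lambda>x. ln x + ln (csc x)) at_top
         (at_left (pi / (real (fib (n + m)) + (-1) ^ m * real (fib (n - m)))))"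
      unfolding lucas_mult_fib[OF assms(2), symmetric] fib_n lucas_m
      using ln_plus_ln_csc_at_left_pi by simp
  qed

  show "(\<lambda>k. zeta (real (2 * Suc k)) /
              (4 ^ Suc k * real (Suc k) * real (fib (n + m)) ^ (2 * Suc k)))
       sums
         (ln (pi / (real (lucas n) * real (fib m) + real (fib n) * real (lucas m))) +
          ln (csc (pi / (real (lucas n) * real (fib m) + real (fib n) * real (lucas m)))))"
  proof -
    have "fib (n + m) \<ge> 1" using n_pos by (intro fib_ge_1) simp
    then have "2 * real (fib (n + m)) > 1" by linarith
    note series = zeta_even_series_reciprocal[OF this]
    have "real (Suc k) * ((2 * real (fib (n + m)))\<^sup>2) ^ Suc k
        = 4 ^ Suc k * real (Suc k) * real (fib (n + m)) ^ (2 * Suc k)" for k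
      unfolding power_mult power_mult_distrib by (simp only: power2_eq_square) simp
    then show ?thesis
      using series unfolding double_fib_add[of n m, symmetric] by (simp only:)
  qed

  show "(\<lambda>k. zeta (real (2 * Suc k)) /
              (real (Suc k) * ((real (lucas m))\<^sup>2 * (real (lucas n))\<^sup>2) ^ Suc k))
       sums
         (ln (pi / (real (lucas (n + m)) + (-1) ^ m * real (lucas (n - m)))) +
          ln (csc (pi / (real (lucas (n + m)) + (-1) ^ m * real (lucas (n - m))))))"
    if "\<not> (m = 1 \<and> n = 1)"
  proof -
    have "1 * 3 \<le> lucas m * lucas n"
      using that assms by (intro mult_le_mono lucas_ge_1 lucas_ge_3) auto
    then have "real (lucas m) * real (lucas n) > 1"
      by (simp flip: of_nat_mult)
    from zeta_even_series_reciprocal[OF this] show ?thesis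
      unfolding lucas_mult_lucas[OF assms(2), symmetric] power_mult_distrib[symmetric] .
  qed

  show "filterlim (\<lambda>N. \<Sum>k<N. zeta (real (2 * Suc k)) /
              (real (Suc k) * ((real (lucas m))\<^sup>2 * (real (lucas n))\<^sup>2) ^ Suc k))
         at_top sequentially"
    and "filterlim (\<lambda>x. ln x + ln (csc x)) at_top
         (at_left (pi / (real (lucas (n + m)) + (-1) ^ m * real (lucas (n - m)))))"
    if "m = 1 \<and> n = 1"
  proof -
    have lucas_m: "lucas m = 1" and lucas_n: "lucas n = 1" using that lucas_1 by simp_all
    show "filterlim (\<lambda>N. \<Sum>k<N. zeta (real (2 * Suc k)) /
              (real (Suc k) * ((real (lucas m))\<^sup>2 * (real (lucas n))\<^sup>2) ^ Suc k))
         at_top sequentially"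
      unfolding lucas_m lucas_n using zeta_even_harmonic_at_top by simp
    show "filterlim (\<lambda>x. ln x + ln (csc x)) at_top
         (at_left (pi / (real (lucas (n + m)) + (-1) ^ m * real (lucas (n - m)))))"
      unfolding lucas_mult_lucas[OF assms(2), symmetric] lucas_m lucas_n
      using ln_plus_ln_csc_at_left_pi by simp
  qed

  show "(\<lambda>k. zeta (real (2 * Suc k)) /
              (25 ^ Suc k * real (Suc k) * ((real (fib m))\<^sup>2 * (real (fib n))\<^sup>2) ^ Suc k))
       sums
         (ln (pi / (real (lucas (n + m)) + (-1) ^ (m - 1) * real (lucas (n - m)))) +
          ln (csc (pi / (real (lucas (n + m)) + (-1) ^ (m - 1) * real (lucas (n - m))))))"
  proof -
    have "1 * 1 \<le> fib m * fib n" using m_pos n_pos by (intro mult_le_mono fib_ge_1) auto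
    then have "1 \<le> real (fib m) * real (fib n)" by (simp flip: of_nat_mult)
    then have "5 * real (fib m) * real (fib n) > 1" by linarith
    note series = zeta_even_series_reciprocal[OF this]
    have "real (Suc k) * ((5 * real (fib m) * real (fib n))\<^sup>2) ^ Suc k
        = 25 ^ Suc k * real (Suc k) * ((real (fib m))\<^sup>2 * (real (fib n))\<^sup>2) ^ Suc k" for k
      unfolding power_mult_distrib by simp
    then show ?thesis
      using series unfolding five_fib_mult_fib[OF assms(2) m_pos, symmetric] by (simp only:)
  qed
qed

end
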